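(* Let $(D_\lambda)_{\lambda\in\Lambda}$ be a family of commutative rings. Then every maximal ideal of $R=\prod_{\lambda\in\Lambda}D_\lambda$ is of the form $(\mathcal{U})$ for some ultrafilter $\mathcal{U}$ in $\mathcal{B}=\prod_{\lambda\in\Lambda}\mathcal{P}(\max(D_\lambda))$.
   Context: Rings are commutative with identity. For a ring $D$, $\max(D)$ is the set of maximal ideals of $D$ and, for $a\in D$, $\mathscr{V}(a)=\{M\in\max(D)\mid a\in M\}$. $\mathcal{B}=\prod_{\lambda\in\Lambda}\mathcal{P}(\max(D_\lambda))$ is the product of the power set Boolean algebras (componentwise intersection, union, complement; least element $(\emptyset)_\lambda$; $Y\le Z$ iff $Y_\lambda\subseteq Z_\lambda$ for all $\lambda$). An ultrafilter in $\mathcal{B}$ is a maximal proper filter of this Boolean algebra. For $a=(a_\lambda)\in R$, $S(a)=(\mathscr{V}(a_\lambda))_{\lambda\in\Lambda}\in\mathcal{B}$, and $(\mathcal{U})=\{a\in R\mid S(a)\in\mathcal{U}\}$. *)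

theory Defs
  imports "HOL-Algebra.Ideal" "HOL-Library.FuncSet"
begin

definition product_ring :: "'i set \<Rightarrow> ('i \<Rightarrow> ('a, 'm) ring_scheme) \<Rightarrow> ('i \<Rightarrow> 'a) ring"
  where "product_ring I D =
    \<lparr>carrier = (\<Pi>\<^sub>E i\<in>I. carrier (D i)),
     monoid.mult = (\<lambda>x y. \<lambda>i\<in>I. x i \<otimes>\<^bsub>D i\<^esub> y i),
     monoid.one = (\<lambda>i\<in>I. \<one>\<^bsub>D i\<^esub>),
     ring.zero = (\<lambda>i\<in>I. \<zero>\<^bsub>D i\<^esub>),
     ring.add = (\<lambda>x y. \<lambda>i\<in>I. x i \<oplus>\<^bsub>D i\<^esub> y i)\<rparr>"

lemma product_ring_cring:
  assumes "\<And>i. i \<in> I \<Longrightarrow> cring (D i)"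
  shows "cring (product_ring I D)"
proof -
  have R: "\<And>i. i \<in> I \<Longrightarrow> ring (D i)" using assms cring.axioms(1) by blast
  show ?thesis
  proof (rule cringI)
    show "abelian_group (product_ring I D)"
    proof (rule abelian_groupI)
      fix x assume x: "x \<in> carrier (product_ring I D)"
      show "\<exists>y\<in>carrier (product_ring I D). y \<oplus>\<^bsub>product_ring I D\<^esub> x = \<zero>\<^bsub>product_ring I D\<^esub>"
        by (rule bexI[where x = "\<lambda>i\<in>I. \<ominus>\<^bsub>D i\<^esub> x i"])
           (use x R in \<open>auto simp: product_ring_def PiE_iff ring.ring_simprules intro!: restrict_ext\<close>)
    qed (use R in \<open>auto simp: product_ring_def PiE_iff extensional_def ring.ring_simprules intro!: restrict_ext ext\<close>)
    show "Group.comm_monoid (product_ring I D)"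
      by (rule Group.comm_monoidI)
         (use assms R in \<open>auto simp: product_ring_def PiE_iff extensional_def ring.ring_simprules
            cring.cring_simprules
            monoid.r_one[OF ring.is_monoid] intro!: restrict_ext ext\<close>)
  qed (use R in \<open>auto simp: product_ring_def PiE_iff ring.ring_simprules intro!: restrict_ext\<close>)
qed

definition max_ideals :: "('a, 'm) ring_scheme \<Rightarrow> 'a set set"
  where "max_ideals D = {M. maximalideal M D}"

definition max_locus :: "('a, 'm) ring_scheme \<Rightarrow> 'a \<Rightarrow> 'a set set"
  where "max_locus D a = {M \<in> max_ideals D. a \<in> M}"

text \<open>
  The next definitions concern the product of the power set Boolean algebras of a family of
  sets \<open>E i\<close>, \<open>i \<in> I\<close>. Its elements are the families of subsets, represented extensionally
  (with value \<open>undefined\<close> outside \<open>I\<close>), so that equality is componentwise equality on \<open>I\<close>.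
\<close>

definition prod_pow :: "'i set \<Rightarrow> ('i \<Rightarrow> 'e set) \<Rightarrow> ('i \<Rightarrow> 'e set) set"
  where "prod_pow I E = (\<Pi>\<^sub>E i\<in>I. Pow (E i))"

definition prod_meet :: "'i set \<Rightarrow> ('i \<Rightarrow> 'e set) \<Rightarrow> ('i \<Rightarrow> 'e set) \<Rightarrow> ('i \<Rightarrow> 'e set)"
  where "prod_meet I Y Z = (\<lambda>i\<in>I. Y i \<inter> Z i)"

definition prod_le :: "'i set \<Rightarrow> ('i \<Rightarrow> 'e set) \<Rightarrow> ('i \<Rightarrow> 'e set) \<Rightarrow> bool"
  where "prod_le I Y Z \<longleftrightarrow> (\<forall>i\<in>I. Y i \<subseteq> Z i)"

definition prod_filter :: "'i set \<Rightarrow> ('i \<Rightarrow> 'e set) \<Rightarrow> ('i \<Rightarrow> 'e set) set \<Rightarrow> bool"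
  where "prod_filter I E F \<longleftrightarrow>
    F \<subseteq> prod_pow I E \<and> F \<noteq> {} \<and>
    (\<forall>Y\<in>F. \<forall>Z\<in>F. prod_meet I Y Z \<in> F) \<and>
    (\<forall>Y\<in>F. \<forall>Z\<in>prod_pow I E. prod_le I Y Z \<longrightarrow> Z \<in> F)"

definition prod_proper_filter :: "'i set \<Rightarrow> ('i \<Rightarrow> 'e set) \<Rightarrow> ('i \<Rightarrow> 'e set) set \<Rightarrow> bool"
  where "prod_proper_filter I E F \<longleftrightarrow> prod_filter I E F \<and> F \<noteq> prod_pow I E"

lemma prod_proper_filter_iff:
  "prod_proper_filter I E F \<longleftrightarrow> prod_filter I E F \<and> (\<lambda>i\<in>I. {}) \<notin> F"
  unfolding prod_proper_filter_def prod_filter_def prod_le_def prod_pow_def by auto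

definition prod_ultrafilter :: "'i set \<Rightarrow> ('i \<Rightarrow> 'e set) \<Rightarrow> ('i \<Rightarrow> 'e set) set \<Rightarrow> bool"
  where "prod_ultrafilter I E U \<longleftrightarrow>
    prod_proper_filter I E U \<and>
    (\<forall>F. prod_proper_filter I E F \<and> U \<subseteq> F \<longrightarrow> F = U)"

definition locus_family :: "'i set \<Rightarrow> ('i \<Rightarrow> ('a, 'm) ring_scheme) \<Rightarrow> ('i \<Rightarrow> 'a) \<Rightarrow> ('i \<Rightarrow> 'a set set)"
  where "locus_family I D a = (\<lambda>i\<in>I. max_locus (D i) (a i))"

definition filter_ideal ::
  "'i set \<Rightarrow> ('i \<Rightarrow> ('a, 'm) ring_scheme) \<Rightarrow> ('i \<Rightarrow> 'a set set) set \<Rightarrow> ('i \<Rightarrow> 'a) set"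
  where "filter_ideal I D U = {a \<in> carrier (product_ring I D). locus_family I D a \<in> U}"

end

theory Submission
  imports Defs "HOL-Algebra.Ring_Divisibility"
begin

text \<open>
  The loci of finitely many elements of \<open>M\<close> have nonempty meet: otherwise in each factor the
  components of these elements generate the unit ideal, and choosing coefficients componentwise
  writes \<open>1\<close> as a combination of elements of \<open>M\<close>. Hence the loci lie in an ultrafilter \<open>U\<close>, so
  that \<open>M \<subseteq> (U)\<close>. Conversely, if \<open>a \<in> (U)\<close> were outside \<open>M\<close>, then \<open>1 = m + r a\<close> with \<open>m \<in> M\<close>
  would make the loci of \<open>m\<close> and \<open>a\<close> disjoint members of \<open>U\<close>.
\<close>

text \<open>Zorn's lemma, with properness recorded as \<open>\<one> \<notin> K\<close>, a condition
  that visibly passes to unions of chains.\<close>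

lemma (in ring) proper_ideal_in_maximalideal:
  assumes J: "ideal J R" and ne: "J \<noteq> carrier R"
  shows "\<exists>M. maximalideal M R \<and> J \<subseteq> M"
proof -
  define \<A> where "\<A> = {K. ideal K R \<and> J \<subseteq> K \<and> \<one> \<notin> K}"
  have "\<one> \<notin> J" using ideal.one_imp_carrier[OF J] ne by blast
  then have "J \<in> \<A>" using J by (simp add: \<A>_def)
  have "\<exists>M\<in>\<A>. \<forall>X\<in>\<A>. M \<subseteq> X \<longrightarrow> X = M"
  proof (rule subset_Zorn_nonempty)
    show "\<A> \<noteq> {}" using \<open>J \<in> \<A>\<close> by blast
    fix C assume C: "C \<noteq> {}" "subset.chain \<A> C"
    then have sub: "C \<subseteq> \<A>" by (simp add: subset_chain_def)
    have "subset.chain {I. ideal I R} C"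
      using C sub unfolding subset_chain_def \<A>_def by blast
    then have "ideal (\<Union>C) R"
      using chain_Union_is_ideal[of C] C(1) by simp
    then show "\<Union>C \<in> \<A>" using C(1) sub unfolding \<A>_def by blast
  qed
  then obtain M where M: "M \<in> \<A>" and max: "\<And>X. X \<in> \<A> \<Longrightarrow> M \<subseteq> X \<Longrightarrow> X = M" by blast
  have "maximalideal M R"
  proof (rule maximalidealI)
    show "ideal M R" using M by (simp add: \<A>_def)
    show "carrier R \<noteq> M" using M by (auto simp: \<A>_def)
    fix K assume K: "ideal K R" "M \<subseteq> K"
    show "K = M \<or> K = carrier R"
      using K M max[of K] ideal.one_imp_carrier[OF K(1)] unfolding \<A>_def by blast
  qed
  then show ?thesis using M by (auto simp: \<A>_def)
qed

text \<open>The sum of \<open>PIdl a\<close> and \<open>Idl X\<close> is an ideal containing all the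
  generators, so minimality puts the generated ideal inside it.\<close>

lemma (in cring) genideal_insert_decomp:
  assumes a: "a \<in> carrier R" and X: "X \<subseteq> carrier R" and t: "t \<in> Idl (insert a X)"
  shows "\<exists>r\<in>carrier R. \<exists>s\<in>Idl X. t = r \<otimes> a \<oplus> s"
proof -
  have ids: "ideal (PIdl a) R" "ideal (Idl X) R"
    using a X by (simp_all add: cgenideal_ideal genideal_ideal)
  have "insert a X \<subseteq> PIdl a \<union> Idl X"
    using cgenideal_self[OF a] genideal_self[OF X] by blast
  moreover have "PIdl a \<union> Idl X \<subseteq> PIdl a <+> Idl X"
    using union_genideal[OF ids] genideal_self[of "PIdl a \<union> Idl X"]
      ideal.Icarr[OF ids(1)] ideal.Icarr[OF ids(2)] by blast
  ultimately have "Idl (insert a X) \<subseteq> PIdl a <+> Idl X"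
    by (intro genideal_minimal add_ideals ids) blast
  then show ?thesis using t unfolding set_add_def' cgenideal_def by blast
qed

text \<open>Passes from the factors to the product: finitely many generators are split off one at a
  time, each with coefficients chosen in all factors at once. The index set may be infinite; only
  \<open>A\<close> has to be finite for the induction.\<close>

lemma mem_ideal_if_mem_genideal_components:
  assumes D: "\<And>i. i \<in> I \<Longrightarrow> cring (D i)"
    and M: "ideal M (product_ring I D)"
    and "finite A" "A \<subseteq> M" "t \<in> carrier (product_ring I D)"
    and "\<And>i. i \<in> I \<Longrightarrow> t i \<in> genideal (D i) ((\<lambda>a. a i) ` A)"
  shows "t \<in> M"
  using assms(3-)
\<comment> \<open>\<open>t\<close> varies because the induction hypothesis is applied to the
  remainder left after removing the multiple of \<open>a\<close>.\<close>
proof (induction A arbitrary: t)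
  case empty
  have "t i = \<zero>\<^bsub>D i\<^esub>" if "i \<in> I" for i
  proof -
    interpret cring "D i" by (rule D[OF that])
    show ?thesis using empty(3)[OF that] genideal_minimal[OF zeroideal, of "{}"] by auto
  qed
  then have "t = \<zero>\<^bsub>product_ring I D\<^esub>"
    using empty(2) by (auto simp: product_ring_def PiE_iff extensional_def)
  then show ?case
    using M by (simp add: additive_subgroup.zero_closed ideal.axioms(1))
next
  case (insert a A)
  have carr: "x i \<in> carrier (D i)" if "x \<in> M" "i \<in> I" for x i
    using ideal.Icarr[OF M that(1)] that(2) by (auto simp: product_ring_def)
  have "\<exists>r s. r \<in> carrier (D i) \<and> s \<in> carrier (D i) \<and> s \<in> genideal (D i) ((\<lambda>a. a i) ` A)
      \<and> t i = r \<otimes>\<^bsub>D i\<^esub> a i \<oplus>\<^bsub>D i\<^esub> s" if i: "i \<in> I" for i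
  proof -
    interpret cring "D i" by (rule D[OF i])
    have X: "(\<lambda>a. a i) ` A \<subseteq> carrier (D i)" using carr insert.prems(1) i by auto
    have "a i \<in> carrier (D i)" using carr insert.prems(1) i by simp
    moreover have "t i \<in> genideal (D i) (insert (a i) ((\<lambda>a. a i) ` A))"
      using insert.prems(3)[OF i] by simp
    ultimately show ?thesis
      using genideal_insert_decomp[OF _ X] ideal.Icarr[OF genideal_ideal[OF X]] by meson
  qed
  \<comment> \<open>The choices in different factors are independent, and every family of elements
    lies in the full product, so \<open>restrict r I\<close> and \<open>restrict s I\<close> are
    elements of the product ring.\<close>
  then obtain r s where rs: "\<And>i. i \<in> I \<Longrightarrow> r i \<in> carrier (D i) \<and> s i \<in> carrier (D i)
      \<and> s i \<in> genideal (D i) ((\<lambda>a. a i) ` A) \<and> t i = r i \<otimes>\<^bsub>D i\<^esub> a i \<oplus>\<^bsub>D i\<^esub> s i"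
    by metis
  have "restrict s I \<in> M"
    using insert.prems(1) rs by (intro insert.IH) (auto simp: product_ring_def)
  moreover have "restrict r I \<otimes>\<^bsub>product_ring I D\<^esub> a \<in> M"
    using insert.prems(1) rs
    by (intro ideal.I_l_closed[OF M]) (auto simp: product_ring_def)
  moreover have "t = (restrict r I \<otimes>\<^bsub>product_ring I D\<^esub> a) \<oplus>\<^bsub>product_ring I D\<^esub> restrict s I"
    using insert.prems(2) rs by (auto simp: product_ring_def PiE_iff extensional_def fun_eq_iff)
  ultimately show ?case
    using additive_subgroup.a_closed[OF ideal.axioms(1)[OF M]] by metis
qed

text \<open>Zorn's lemma again: omitting the least element, the equivalent form of properness,
  survives unions of chains.\<close>

lemma prod_proper_filter_in_ultrafilter:
  assumes F: "prod_proper_filter I E F"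
  shows "\<exists>U. prod_ultrafilter I E U \<and> F \<subseteq> U"
proof -
  define \<A> where "\<A> = {G. prod_proper_filter I E G \<and> F \<subseteq> G}"
  have "\<exists>U\<in>\<A>. \<forall>G\<in>\<A>. U \<subseteq> G \<longrightarrow> G = U"
  proof (rule subset_Zorn_nonempty)
    show "\<A> \<noteq> {}" using F by (auto simp: \<A>_def)
    fix C assume C: "C \<noteq> {}" "subset.chain \<A> C"
    have el: "prod_filter I E G" "(\<lambda>i\<in>I. {}) \<notin> G" "F \<subseteq> G" if "G \<in> C" for G
      using C(2) that unfolding subset_chain_def \<A>_def prod_proper_filter_iff by blast+
    have "prod_meet I Y Z \<in> \<Union>C" if YZ: "Y \<in> \<Union>C" "Z \<in> \<Union>C" for Y Z
    proof -
      \<comment> \<open>Members of a chain are comparable, so the larger of the two filters contains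
        both families.\<close>
      obtain G where "G \<in> C" "Y \<in> G" "Z \<in> G"
        using YZ C(2) unfolding subset_chain_def by blast
      then show ?thesis using el(1) unfolding prod_filter_def by blast
    qed
    moreover have "\<Union>C \<subseteq> prod_pow I E" "\<Union>C \<noteq> {}"
      using el(1) C(1) unfolding prod_filter_def by blast+
    moreover have "Z \<in> \<Union>C" if "Y \<in> \<Union>C" "Z \<in> prod_pow I E" "prod_le I Y Z" for Y Z
      using el(1) that unfolding prod_filter_def by blast
    ultimately have "prod_filter I E (\<Union>C)" unfolding prod_filter_def by blast
    then show "\<Union>C \<in> \<A>"
      using el C(1) unfolding \<A>_def prod_proper_filter_iff by blast
  qed
  then obtain U where U: "prod_proper_filter I E U" "F \<subseteq> U"
    and max: "\<And>G. G \<in> \<A> \<Longrightarrow> U \<subseteq> G \<Longrightarrow> G = U"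
    by (auto simp: \<A>_def)
  have "G = U" if "prod_proper_filter I E G" "U \<subseteq> G" for G
    using max[of G] that U(2) by (auto simp: \<A>_def)
  then show ?thesis using U unfolding prod_ultrafilter_def by (intro exI[of _ U]) simp
qed

theorem corollary2p3:
  fixes I :: "'i set"
    and D :: "'i \<Rightarrow> ('a, 'm) ring_scheme"
    and M :: "('i \<Rightarrow> 'a) set"
  assumes "\<And>i. i \<in> I \<Longrightarrow> cring (D i)"
    and "maximalideal M (product_ring I D)"
  shows "\<exists>U. prod_ultrafilter I (\<lambda>i. max_ideals (D i)) U \<and> M = filter_ideal I D U"
proof -
  let ?R = "product_ring I D" and ?E = "\<lambda>i. max_ideals (D i)"
  note D = assms(1)
  interpret R: cring ?R by (rule product_ring_cring[OF D])
  interpret M: maximalideal M ?R by (rule assms(2))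
  \<comment> \<open>\<open>below A Y\<close> expresses that the meet of the loci of the elements of
    \<open>A\<close> is at most \<open>Y\<close>, without forming that meet. Thus \<open>F\<close>
    below is the filter generated by the loci of elements of \<open>M\<close>; the empty
    \<open>A\<close> stands for the top family.\<close>
  define below where "below A Y \<longleftrightarrow>
    (\<forall>i\<in>I. \<forall>P\<in>max_ideals (D i). (\<forall>a\<in>A. a i \<in> P) \<longrightarrow> P \<in> Y i)"
    for A :: "('i \<Rightarrow> 'a) set" and Y :: "'i \<Rightarrow> 'a set set"
  define F where "F = {Y \<in> prod_pow I ?E. \<exists>A. finite A \<and> A \<subseteq> M \<and> below A Y}"
  have one: "\<one>\<^bsub>?R\<^esub> \<notin> M" using M.one_imp_carrier M.I_notcarr by blast
  have locus: "locus_family I D a \<in> prod_pow I ?E" for a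
    by (auto simp: locus_family_def prod_pow_def max_locus_def)
  have "prod_filter I ?E F"
    unfolding prod_filter_def
  proof (intro conjI ballI impI)
    show "F \<subseteq> prod_pow I ?E" by (auto simp: F_def)
    have "(\<lambda>i\<in>I. max_ideals (D i)) \<in> F"
      unfolding F_def by (auto simp: prod_pow_def below_def intro!: exI[of _ "{}"])
    then show "F \<noteq> {}" by blast
  next
    fix Y Z assume "Y \<in> F" "Z \<in> F"
    then obtain A B where AB: "finite A" "A \<subseteq> M" "below A Y" "finite B" "B \<subseteq> M" "below B Z"
      and YZ: "Y \<in> prod_pow I ?E" "Z \<in> prod_pow I ?E" unfolding F_def by blast
    have "below (A \<union> B) (prod_meet I Y Z)"
      using AB(3,6) by (simp add: below_def prod_meet_def)
    moreover have "prod_meet I Y Z \<in> prod_pow I ?E"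
      using YZ by (auto simp: prod_meet_def prod_pow_def)
    ultimately show "prod_meet I Y Z \<in> F"
      using AB unfolding F_def by (blast intro: finite_UnI)
  next
    fix Y Z assume Y: "Y \<in> F" and Z: "Z \<in> prod_pow I ?E" and le: "prod_le I Y Z"
    have "below A Z" if "below A Y" for A
      using that le unfolding below_def prod_le_def by blast
    then show "Z \<in> F" using Y Z unfolding F_def by blast
  qed
  moreover have "(\<lambda>i\<in>I. {}) \<notin> F"
  proof
    assume "(\<lambda>i\<in>I. {}) \<in> F"
    then obtain A where A: "finite A" "A \<subseteq> M" "below A (\<lambda>i\<in>I. {})" unfolding F_def by blast
    \<comment> \<open>Since \<open>A\<close> lies below the empty family, no maximal ideal of
      \<open>D i\<close> contains all the \<open>i\<close>-th components of \<open>A\<close>; they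
      therefore generate the unit ideal.\<close>
    have "\<one>\<^bsub>?R\<^esub> i \<in> genideal (D i) ((\<lambda>a. a i) ` A)" if i: "i \<in> I" for i
    proof -
      interpret Di: cring "D i" by (rule D[OF i])
      have X: "(\<lambda>a. a i) ` A \<subseteq> carrier (D i)"
        using A(2) M.Icarr i by (auto simp: product_ring_def)
      have "genideal (D i) ((\<lambda>a. a i) ` A) = carrier (D i)"
      proof (rule ccontr)
        assume "\<not> ?thesis"
        then obtain P where "maximalideal P (D i)" "genideal (D i) ((\<lambda>a. a i) ` A) \<subseteq> P"
          using Di.proper_ideal_in_maximalideal[OF Di.genideal_ideal[OF X]] by blast
        then show False
          using Di.genideal_self[OF X] A(3) i by (fastforce simp: below_def max_ideals_def)
      qed
      then show ?thesis using i by (simp add: product_ring_def)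
    qed
    then have "\<one>\<^bsub>?R\<^esub> \<in> M"
      using mem_ideal_if_mem_genideal_components[OF D M.is_ideal A(1,2) R.one_closed] by blast
    then show False using one by blast
  qed
  ultimately have "prod_proper_filter I ?E F" by (simp add: prod_proper_filter_iff)
  then obtain U where U: "prod_ultrafilter I ?E U" "F \<subseteq> U"
    using prod_proper_filter_in_ultrafilter by blast
  have U_filter: "prod_filter I ?E U" "(\<lambda>i\<in>I. {}) \<notin> U"
    using U(1) unfolding prod_ultrafilter_def prod_proper_filter_iff by blast+
  have locus_U: "locus_family I D m \<in> U" if "m \<in> M" for m
  proof -
    have "below {m} (locus_family I D m)"
      by (simp add: below_def locus_family_def max_locus_def)
    then have "locus_family I D m \<in> F"
      using locus that unfolding F_def by blast
    then show ?thesis using U(2) by blast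
  qed
  have "M = filter_ideal I D U"
  proof
    show "M \<subseteq> filter_ideal I D U"
      using locus_U M.Icarr by (auto simp: filter_ideal_def)
    show "filter_ideal I D U \<subseteq> M"
    proof (rule subsetI, rule ccontr)
      fix a assume "a \<in> filter_ideal I D U" and aM: "a \<notin> M"
      then have a: "a \<in> carrier ?R" and aU: "locus_family I D a \<in> U"
        by (auto simp: filter_ideal_def)
      have sub: "insert a M \<subseteq> carrier ?R" "M \<subseteq> carrier ?R" using a M.Icarr by auto
      \<comment> \<open>This ideal contains \<open>M\<close> and also \<open>a\<close>, which is
        outside \<open>M\<close>, so maximality leaves only the whole ring.\<close>
      have "genideal ?R (insert a M) = carrier ?R"
        using M.I_maximal[OF R.genideal_ideal[OF sub(1)]] R.genideal_self[OF sub(1)] aM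
          ideal.Icarr[OF R.genideal_ideal[OF sub(1)]] by blast
      then obtain r m where r: "r \<in> carrier ?R" and "m \<in> genideal ?R M"
        and eq: "\<one>\<^bsub>?R\<^esub> = r \<otimes>\<^bsub>?R\<^esub> a \<oplus>\<^bsub>?R\<^esub> m"
        using R.genideal_insert_decomp[OF a sub(2)] by blast
      then have m: "m \<in> M"
        using R.genideal_minimal[OF M.is_ideal] by blast
      \<comment> \<open>A maximal ideal in both loci would contain the \<open>i\<close>-th component
        of \<open>r \<otimes> a \<oplus> m\<close>, which is the identity of
        \<open>D i\<close>.\<close>
      have "max_locus (D i) (a i) \<inter> max_locus (D i) (m i) = {}" if i: "i \<in> I" for i
      proof (rule equals0I)
        fix P assume "P \<in> max_locus (D i) (a i) \<inter> max_locus (D i) (m i)"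
        then have P: "maximalideal P (D i)" "a i \<in> P" "m i \<in> P"
          by (auto simp: max_locus_def max_ideals_def)
        interpret P: maximalideal P "D i" by (rule P(1))
        have "\<one>\<^bsub>D i\<^esub> = r i \<otimes>\<^bsub>D i\<^esub> a i \<oplus>\<^bsub>D i\<^esub> m i"
          using fun_cong[OF eq, of i] i by (simp add: product_ring_def)
        moreover have "r i \<in> carrier (D i)" using r i by (auto simp: product_ring_def)
        ultimately have "\<one>\<^bsub>D i\<^esub> \<in> P"
          using P(2,3) by (simp add: P.I_l_closed P.a_closed)
        then show False using P.one_imp_carrier P.I_notcarr by blast
      qed
      then have "prod_meet I (locus_family I D a) (locus_family I D m) = (\<lambda>i\<in>I. {})"
        by (auto simp: prod_meet_def locus_family_def fun_eq_iff)
      moreover have "prod_meet I (locus_family I D a) (locus_family I D m) \<in> U"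
        using U_filter(1) aU locus_U[OF m] unfolding prod_filter_def by blast
      ultimately show False using U_filter(2) by simp
    qed
  qed
  then show ?thesis using U(1) by blast
qed

end
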